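(* Let $\mathcal{N}=\{1,\dots,n\}$ be a universe of products with preference weights $v_1\ge\cdots\ge v_n>0$, and let $T\ge 1$ be the number of customers. There exists a preference-weight-ordered assortment $S\subseteq\mathcal{N}$ such that $$\mathbb{E}(M(S))\ \ge\ \frac12\cdot\max_{S'\subseteq\mathcal{N}}\mathbb{E}(M(S')).$$ Moreover, a preference-weight-ordered assortment with this property can be computed in polynomial time.
   Context: Multinomial Logit (MNL) model: each product $i\in\mathcal{N}$ has preference weight $v_i>0$ and the no-purchase option $0$ has weight $1$. For an assortment $S\subseteq\mathcal{N}$ let $v(S)=\sum_{i\in S}v_i$, $\phi_i(S)=\frac{v_i}{1+v(S)}$ for $i\in S$, and $\phi_0(S)=\frac{1}{1+v(S)}$. When $S$ is offered to $T$ customers, each customer independently chooses option $i\in S\cup\{0\}$ with probability $\phi_i(S)$. The load $L_i(S)$ is the (random) number of customers choosing product $i$, and $M(S)=\max_{i\in S}L_i(S)$ (with $M(\emptyset)=0$). With products indexed so that $v_1\ge\cdots\ge v_n$, an assortment is called preference-weight-ordered if it is of the form $\{1,2,\dots,j\}$ for some $1\le j\le n$. Polynomial time means a number of elementary arithmetic operations polynomial in $n$ and $T$. *)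

theory Defs
  imports "HOL-Probability.Probability" "HOL-Probability.Product_PMF"
begin

section \<open>The multinomial logit model\<close>

text \<open>Products are the numbers \<open>1, \<dots>, n\<close>; the number \<open>0\<close> is the no-purchase option.\<close>

definition total_weight :: "(nat \<Rightarrow> real) \<Rightarrow> nat set \<Rightarrow> real" where
  "total_weight v S = (\<Sum>i\<in>S. v i)"

definition choice_prob :: "(nat \<Rightarrow> real) \<Rightarrow> nat set \<Rightarrow> nat \<Rightarrow> real" where
  "choice_prob v S i =
     (if i = 0 then 1 / (1 + total_weight v S)
      else if i \<in> S then v i / (1 + total_weight v S)
      else 0)"

definition choice_pmf :: "(nat \<Rightarrow> real) \<Rightarrow> nat set \<Rightarrow> nat pmf" where
  "choice_pmf v S = embed_pmf (choice_prob v S)"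

text \<open>\<^const>\<open>embed_pmf\<close> is only meaningful for a nonnegative function of total mass one;
  the following lemma shows that this is the case here.\<close>

lemma pmf_choice_pmf:
  assumes "finite S" "0 \<notin> S" "\<And>i. i \<in> S \<Longrightarrow> v i > 0"
  shows "pmf (choice_pmf v S) i = choice_prob v S i"
proof -
  have tot: "total_weight v S \<ge> 0"
    unfolding total_weight_def by (intro sum_nonneg) (use assms in \<open>auto intro: less_imp_le\<close>)
  have nn: "choice_prob v S j \<ge> 0" for j
    using tot assms(3)[of j] by (auto simp: choice_prob_def intro!: divide_nonneg_pos less_imp_le)
  have "(\<integral>\<^sup>+ x. ennreal (choice_prob v S x) \<partial>count_space UNIV)
      = (\<Sum>x\<in>insert 0 S. ennreal (choice_prob v S x))"
    using assms(1) by (intro nn_integral_count_space'[symmetric, THEN sym])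
      (auto simp: choice_prob_def)
  also have "\<dots> = ennreal (\<Sum>x\<in>insert 0 S. choice_prob v S x)"
    using nn by (simp add: sum_ennreal)
  also have "(\<Sum>x\<in>insert 0 S. choice_prob v S x)
      = 1 / (1 + total_weight v S) + (\<Sum>x\<in>S. v x / (1 + total_weight v S))"
    using assms(1,2) by (auto simp: choice_prob_def intro!: sum.cong)
  also have "\<dots> = 1"
    using tot by (simp add: total_weight_def flip: sum_divide_distrib add_divide_distrib)
  finally show ?thesis
    unfolding choice_pmf_def using nn by (intro pmf_embed_pmf) auto
qed

text \<open>An outcome \<open>\<omega>\<close> maps each customer \<open>t < T\<close> to the option chosen. The third argument of
  \<^const>\<open>Pi_pmf\<close> is only the value of \<open>\<omega>\<close> outside \<open>{..<T}\<close>.\<close>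

definition customers_pmf :: "(nat \<Rightarrow> real) \<Rightarrow> nat \<Rightarrow> nat set \<Rightarrow> (nat \<Rightarrow> nat) pmf" where
  "customers_pmf v T S = Pi_pmf {..<T} 0 (\<lambda>_. choice_pmf v S)"

definition load :: "nat \<Rightarrow> (nat \<Rightarrow> nat) \<Rightarrow> nat \<Rightarrow> nat" where
  "load T \<omega> i = card {t \<in> {..<T}. \<omega> t = i}"

definition max_load :: "nat \<Rightarrow> nat set \<Rightarrow> (nat \<Rightarrow> nat) \<Rightarrow> nat" where
  "max_load T S \<omega> = (if S = {} then 0 else Max (load T \<omega> ` S))"

definition expected_max_load :: "(nat \<Rightarrow> real) \<Rightarrow> nat \<Rightarrow> nat set \<Rightarrow> real" where
  "expected_max_load v T S =
     measure_pmf.expectation (customers_pmf v T S) (\<lambda>\<omega>. real (max_load T S \<omega>))"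

definition mnl_instance :: "nat \<Rightarrow> nat \<Rightarrow> (nat \<Rightarrow> real) \<Rightarrow> bool" where
  "mnl_instance n T v \<longleftrightarrow>
     n \<ge> 1 \<and> T \<ge> 1 \<and> antimono_on {1..n} v \<and> (\<forall>i\<in>{1..n}. v i > 0)"

definition preference_weight_ordered :: "nat \<Rightarrow> nat set \<Rightarrow> bool" where
  "preference_weight_ordered n S \<longleftrightarrow> (\<exists>j\<in>{1..n}. S = {1..j})"

definition half_optimal :: "nat \<Rightarrow> nat \<Rightarrow> (nat \<Rightarrow> real) \<Rightarrow> nat set \<Rightarrow> bool" where
  "half_optimal n T v S \<longleftrightarrow>
     expected_max_load v T S \<ge> 1 / 2 * Max (expected_max_load v T ` Pow {1..n})"


section \<open>Polynomial-time computation with real arithmetic\<close>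

text \<open>
  Running time is the number of elementary arithmetic operations, as in the real RAM
  (Blum--Shub--Smale) model. A program manipulates finitely many index registers, which hold
  natural numbers, and an unbounded memory of real cells, which are addressed indirectly: below,
  an argument \<open>a\<close> of a real operation names the index register that contains the address. There is
  no multiplication on index registers, no rounding, no conversion between reals and naturals, and
  the only constants are naturals, so no exponential amount of work hides in a single step.
\<close>

type_synonym state = "(nat \<Rightarrow> nat) \<times> (nat \<Rightarrow> real)"

datatype arith = Plus | Minus | Times | Divide

fun arith_fun :: "arith \<Rightarrow> real \<Rightarrow> real \<Rightarrow> real" where
  "arith_fun Plus x y = x + y"
| "arith_fun Minus x y = x - y"
| "arith_fun Times x y = x * y"
| "arith_fun Divide x y = x / y"

datatype test =
    Index_Less nat nat
  | Real_Less nat nat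

fun holds :: "test \<Rightarrow> state \<Rightarrow> bool" where
  "holds (Index_Less a b) (r, m) \<longleftrightarrow> r a < r b"
| "holds (Real_Less a b) (r, m) \<longleftrightarrow> m (r a) < m (r b)"

datatype program =
    Index_Const nat nat
  | Index_Add nat nat nat
  | Index_Sub nat nat nat
  | Real_Const nat nat
  | Real_Arith arith nat nat nat
  | Seq program program
  | Cond test program program
  | While test program

text \<open>\<open>runs p s k s'\<close>: started in \<open>s\<close>, program \<open>p\<close> terminates in \<open>s'\<close> after \<open>k\<close> steps, where every
  operation and every evaluation of a test is one step. A program dividing by zero is stuck.
  Subtraction of indices is truncated.\<close>

inductive runs :: "program \<Rightarrow> state \<Rightarrow> nat \<Rightarrow> state \<Rightarrow> bool" where
  Index_Const: "runs (Index_Const a c) (r, m) 1 (r(a := c), m)"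
| Index_Add: "runs (Index_Add a b c) (r, m) 1 (r(a := r b + r c), m)"
| Index_Sub: "runs (Index_Sub a b c) (r, m) 1 (r(a := r b - r c), m)"
| Real_Const: "runs (Real_Const a c) (r, m) 1 (r, m(r a := real c))"
| Real_Arith: "(f = Divide \<Longrightarrow> m (r c) \<noteq> 0) \<Longrightarrow>
    runs (Real_Arith f a b c) (r, m) 1 (r, m(r a := arith_fun f (m (r b)) (m (r c))))"
| Seq: "runs p s k s' \<Longrightarrow> runs q s' l s'' \<Longrightarrow> runs (Seq p q) s (k + l) s''"
| Cond_True: "holds b s \<Longrightarrow> runs p s k s' \<Longrightarrow> runs (Cond b p q) s (Suc k) s'"
| Cond_False: "\<not> holds b s \<Longrightarrow> runs q s k s' \<Longrightarrow> runs (Cond b p q) s (Suc k) s'"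
| While_False: "\<not> holds b s \<Longrightarrow> runs (While b p) s 1 s"
| While_True: "holds b s \<Longrightarrow> runs p s k s' \<Longrightarrow> runs (While b p) s' l s'' \<Longrightarrow>
    runs (While b p) s (Suc (k + l)) s''"

inductive_cases runs_elims:
  "runs (Index_Const a c) s k s'" "runs (Index_Add a b c) s k s'" "runs (Index_Sub a b c) s k s'"
  "runs (Real_Const a c) s k s'" "runs (Real_Arith f a b c) s k s'" "runs (Seq p q) s k s'"
  "runs (Cond b p q) s k s'"

inductive_cases runs_WhileE: "runs (While b p) s k s'"

text \<open>Result and running time are determined by the program and the initial state, so that
  existence of a run within a time bound expresses total correctness.\<close>

lemma runs_deterministic:
  "runs p s k s' \<Longrightarrow> runs p s l s'' \<Longrightarrow> k = l \<and> s' = s''"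
proof (induction arbitrary: l s'' rule: runs.induct)
  case (Seq p s k s' q l s'')
  from Seq.prems show ?case by (rule runs_elims(6)) (use Seq.IH in blast)
next
  case (Cond_True b s p k s' q)
  from Cond_True.prems show ?case by (rule runs_elims(7)) (use Cond_True in blast)+
next
  case (Cond_False b s q k s' p)
  from Cond_False.prems show ?case by (rule runs_elims(7)) (use Cond_False in blast)+
next
  case (While_False b s p)
  from While_False.prems show ?case by (rule runs_WhileE) (use While_False in auto)
next
  case (While_True b s p k s' l s'')
  from While_True.prems show ?case by (rule runs_WhileE) (use While_True in blast)+
qed (auto elim: runs_elims)

text \<open>Input: \<open>n\<close> and \<open>T\<close> in the index registers \<open>0\<close> and \<open>1\<close>, the weight \<open>v i\<close> in the real cell
  \<open>i\<close> for \<open>1 \<le> i \<le> n\<close>, and zero everywhere else. The output \<open>j\<close>, encoding the assortment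
  \<open>{1..j}\<close>, is read off index register \<open>0\<close>.\<close>

definition input_state :: "nat \<Rightarrow> nat \<Rightarrow> (nat \<Rightarrow> real) \<Rightarrow> state" where
  "input_state n T v =
     ((\<lambda>_. 0)(0 := n, 1 := T), (\<lambda>i. if i \<in> {1..n} then v i else 0))"

definition output_index :: "state \<Rightarrow> nat" where
  "output_index s = fst s 0"

definition polynomial2 :: "(nat \<Rightarrow> nat \<Rightarrow> nat) \<Rightarrow> bool" where
  "polynomial2 f \<longleftrightarrow>
     (\<exists>(d::nat) (c :: nat \<Rightarrow> nat \<Rightarrow> nat). \<forall>n T. f n T = (\<Sum>a\<le>d. \<Sum>b\<le>d. c a b * n ^ a * T ^ b))"

end

theory Submission
  imports Defs
begin

text \<open>
  The assortment that works is the greedy one: add products in order of decreasing weight and stop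
  as soon as the total weight reaches \<open>1\<close> (or the products run out). With \<open>W\<close> the weight of this
  prefix \<open>J\<close>, a customer buys product \<open>i \<in> J\<close> with probability \<open>q\<^sub>i = v\<^sub>i / (1 + W)\<close>. It is
  compared with an arbitrary assortment \<open>S\<close> with probabilities \<open>p\<close> in two steps.

  \<^item> Thinning (\<open>thinning\<close>): if every purchase under \<open>p\<close> is cancelled by a fair coin, both the
    cancelled and the remaining purchases are distributed according to \<open>p / 2\<close>. The two
    maximum loads add up to at least the original one, so the expected maximum load under \<open>p / 2\<close>
    is at least half of that under \<open>p\<close>.

  \<^item> Concentration (\<open>peak_dominated\<close>): the greedy probabilities \<open>q\<close> dominate \<open>p / 2\<close>. On the one
    hand \<open>p\<^sub>k / 2 \<le> v\<^sub>k / (2 (1 + v\<^sub>k)) \<le> v\<^sub>i / (2 (1 + v\<^sub>i)) \<le> q\<^sub>i\<close> whenever \<open>i \<in> J\<close> and \<open>i \<le> k\<close>;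
    the last inequality holds because the prefix without its last product \<open>j\<close> weighs less than \<open>1\<close>,
    so that \<open>W < 1 + v\<^sub>j \<le> 1 + v\<^sub>i\<close>. On the other hand \<open>p / 2\<close> has total mass at most \<open>1 / 2\<close>, and
    \<open>q\<close> at least \<open>1 / 2\<close> when \<open>W \<ge> 1\<close>; when \<open>W < 1\<close>, there are no products outside \<open>J\<close>. Hence \<open>q\<close>
    is reached from \<open>p / 2\<close> by moving probability from products outside \<open>J\<close> to products inside and
    by adding probability, and neither kind of move lowers the expected maximum load.

  That a move from \<open>k\<close> to \<open>i\<close> helps is \<open>move_prob_increases\<close>: as a function of the amount moved, the
  expectation is convex, because the maximum is a convex function of the loads, and it is symmetric
  about the amount that equalises the two products.

  No expected load has to be computed to find the greedy prefix: partial sums of the weights determine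
  it, and one scan suffices.
\<close>

section \<open>The customers as a Markov chain on load vectors\<close>

definition bump :: "(nat \<Rightarrow> nat) \<Rightarrow> nat \<Rightarrow> nat \<Rightarrow> nat" where
  "bump x a = x(a := Suc (x a))"

text \<open>The missing mass of a subdistribution is the probability of buying nothing.\<close>

definition subdist :: "nat set \<Rightarrow> (nat \<Rightarrow> real) \<Rightarrow> bool" where
  "subdist N p \<longleftrightarrow> finite N \<and> (\<forall>a\<in>N. 0 \<le> p a) \<and> sum p N \<le> 1"

text \<open>Transition operator of one more customer: the expectation of \<open>g\<close> after a customer who buys \<open>a\<close>
  with probability \<open>p a\<close> has been added to the loads \<open>x\<close>. Writing the no-purchase outcome as ``no
  change'' makes the operator affine in \<open>p\<close> without a constraint on the total mass.\<close>

definition step :: "nat set \<Rightarrow> (nat \<Rightarrow> real) \<Rightarrow> ((nat \<Rightarrow> nat) \<Rightarrow> real) \<Rightarrow> (nat \<Rightarrow> nat) \<Rightarrow> real" where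
  "step N p g x = g x + (\<Sum>a\<in>N. p a * (g (bump x a) - g x))"

definition peak :: "nat set \<Rightarrow> (nat \<Rightarrow> nat) \<Rightarrow> real" where
  "peak N x = (if N = {} then 0 else real (Max (x ` N)))"

lemma bump_commute: "bump (bump x a) b = bump (bump x b) a"
  by (auto simp: bump_def fun_eq_iff)

lemma step_convex_form:
  "step N p g x = (1 - sum p N) * g x + (\<Sum>a\<in>N. p a * g (bump x a))"
  by (simp add: step_def algebra_simps sum_subtractf sum_distrib_left)

lemma step_mono:
  assumes "subdist N p" "\<And>x. g x \<le> h x"
  shows "step N p g x \<le> step N p h x"
  unfolding step_convex_form
  by (intro add_mono mult_left_mono sum_mono) (use assms in \<open>auto simp: subdist_def\<close>)

lemma step_linear:
  "step N p (\<lambda>x. c * g x + d * h x) x = c * step N p g x + d * step N p h x"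
  by (simp add: step_convex_form algebra_simps sum.distrib sum_distrib_left)

lemma step_diff: "step N p (\<lambda>x. g x - h x) x = step N p g x - step N p h x"
  using step_linear[of N p 1 g "-1" h x] by simp

lemma iterate_step_mono:
  assumes "subdist N p" "\<And>x. g x \<le> h x"
  shows "(step N p ^^ T) g x \<le> (step N p ^^ T) h x"
  by (induction T arbitrary: x) (simp_all add: assms step_mono)

lemma iterate_step_nonneg:
  assumes "subdist N p" "\<And>x. 0 \<le> g x"
  shows "0 \<le> (step N p ^^ T) g x"
proof (induction T arbitrary: x)
  case (Suc T)
  have "step N p (\<lambda>_. 0) x = 0"
    by (simp add: step_def)
  then show ?case
    using step_mono[OF assms(1), of "\<lambda>_. 0" "(step N p ^^ T) g" x] Suc.IH by simp
qed (simp add: assms)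

text \<open>From loads that vanish outside \<open>J\<close>, a chain that buys only products of \<open>J\<close> never leaves the set
  of such loads.\<close>

lemma iterate_step_cong_on_support:
  assumes "finite N" "\<And>a. a \<in> N - J \<Longrightarrow> p a = 0"
    and "\<And>x. (\<And>a. a \<in> N - J \<Longrightarrow> x a = 0) \<Longrightarrow> g x = h x"
    and "\<And>a. a \<in> N - J \<Longrightarrow> x a = 0"
  shows "(step N p ^^ T) g x = (step N p ^^ T) h x"
  using assms(4)
proof (induction T arbitrary: x)
  case (Suc T)
  have "p a * (step N p ^^ T) g (bump x a) = p a * (step N p ^^ T) h (bump x a)" if "a \<in> N" for a
  proof (cases "a \<in> J")
    case True
    have "bump x a b = 0" if "b \<in> N - J" for b
      using True that Suc.prems[OF that] by (cases "b = a") (simp_all add: bump_def)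
    from Suc.IH[OF this] show ?thesis by simp
  qed (use assms(2) that in simp)
  note bumped = this
  have step: "step N p G x = step N p H x"
    if "\<And>a. a \<in> N \<Longrightarrow> p a * G (bump x a) = p a * H (bump x a)" "G x = H x" for G H
    unfolding step_convex_form that(2) by (intro arg_cong2[where f = "(+)"] sum.cong refl that(1))
  have "step N p ((step N p ^^ T) g) x = step N p ((step N p ^^ T) h) x"
    by (rule step[OF bumped Suc.IH[OF Suc.prems]])
  then show ?case by simp
qed (use assms(3) in simp)

section \<open>Expected maximum load as an iterated expectation\<close>

lemma load_Suc: "load (Suc T) (c(T := y)) = bump (load T c) y"
proof
  fix i
  have "{t \<in> {..<Suc T}. (c(T := y)) t = i} = 
     {t \<in> {..<T}. c t = i} \<union> (if y = i then {T} else {})"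
    by (auto simp: less_Suc_eq)
  then show "load (Suc T) (c(T := y)) i = bump (load T c) y i"
    by (simp add: load_def bump_def)
qed

text \<open>The last customer is independent of the others, so averaging over that customer's choice first
  replaces \<open>g\<close> by \<open>step N p g\<close>. The options \<open>S\<close> offered may be a proper subset of \<open>N\<close>, which puts
  all assortments on a common index set.\<close>

lemma expectation_loads:
  assumes "finite N" "0 \<notin> N" "S \<subseteq> N" "\<And>i. i \<in> S \<Longrightarrow> v i > 0"
    and "\<And>x. g (bump x 0) = g x"
  shows "measure_pmf.expectation (customers_pmf v T S) (\<lambda>c. g (load T c)) =
    (step N (choice_prob v S) ^^ T) g (\<lambda>_. 0)"
  using assms(5)
proof (induction T arbitrary: g)
  case 0
  have "load 0 (\<lambda>_. 0) = (\<lambda>_. 0)"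
    by (simp add: load_def fun_eq_iff)
  then show ?case
    by (simp add: customers_pmf_def)
next
  case (Suc T)
  let ?p = "choice_prob v S" and ?d = "choice_pmf v S"
  have finS: "finite S" and S0: "0 \<notin> S"
    using assms finite_subset by auto
  have pmf: "pmf ?d i = ?p i" for i
    using pmf_choice_pmf[of S v i] assms(4) finS S0 by auto
  have supp: "set_pmf ?d \<subseteq> insert 0 S"
    by (auto simp: set_pmf_eq pmf choice_prob_def split: if_splits)
  have finPi: "finite (set_pmf (customers_pmf v T S))"
    unfolding customers_pmf_def
    by (rule finite_subset[OF set_Pi_pmf_subset'])
      (auto intro!: finite_PiE_dflt finite_subset[OF supp] simp: finS)
  have "(\<Sum>i\<in>insert 0 N. ?p i) = (\<Sum>i\<in>insert 0 N. pmf ?d i)"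
    by (simp add: pmf)
  also have "\<dots> = 1"
    using supp assms by (intro sum_pmf_eq_1) auto
  finally have p0: "?p 0 = 1 - sum ?p N"
    using assms(1,2) by simp
  have one: "measure_pmf.expectation ?d (\<lambda>y. g (bump x y)) = step N ?p g x" for x
  proof -
    have "measure_pmf.expectation ?d (\<lambda>y. g (bump x y)) = (\<Sum>y\<in>insert 0 N. g (bump x y) * pmf ?d y)"
      using supp assms(1,3) by (intro integral_measure_pmf_real) auto
    also have "\<dots> = step N ?p g x"
      using assms(1,2) by (simp add: step_convex_form pmf p0 Suc.prems mult.commute)
    finally show ?thesis .
  qed
  have inv: "step N ?p g (bump x 0) = step N ?p g x" for x
    by (simp add: step_def Suc.prems bump_commute[of x 0])
  have eq: "customers_pmf v (Suc T) S =
      map_pmf (\<lambda>(y, c). c(T := y)) (pair_pmf ?d (customers_pmf v T S))"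
    unfolding customers_pmf_def lessThan_Suc by (subst Pi_pmf_insert) auto
  have "measure_pmf.expectation (customers_pmf v (Suc T) S) (\<lambda>c. g (load (Suc T) c)) =
     measure_pmf.expectation (pair_pmf (customers_pmf v T S) ?d) (\<lambda>(c, y). g (bump (load T c) y))"
    unfolding eq by (subst pair_commute_pmf) (simp add: case_prod_unfold load_Suc)
  also have "\<dots> = measure_pmf.expectation (customers_pmf v T S) (\<lambda>c. step N ?p g (load T c))"
    unfolding pair_pmf_def one[symmetric]
    by (subst pmf_expectation_bind[OF finPi])
      (auto simp: finPi integral_measure_pmf_real[OF finPi] map_pmf_def[symmetric] 
         intro!: finite_subset[OF supp] finS sum.cong)
  also have "\<dots> = (step N ?p ^^ Suc T) g (\<lambda>_. 0)"
    using Suc.IH[of "step N ?p g"] inv by (simp add: funpow_swap1)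
  finally show ?case .
qed

lemma expected_max_load_eq:
  assumes "finite N" "0 \<notin> N" "S \<subseteq> N" "\<And>i. i \<in> S \<Longrightarrow> v i > 0"
  shows "expected_max_load v T S = (step N (choice_prob v S) ^^ T) (peak S) (\<lambda>_. 0)"
proof -
  have "peak S (bump x 0) = peak S x" for x
  proof -
    have "a \<noteq> 0" if "a \<in> S" for a
      using assms(2,3) that by (metis subsetD)
    then have "bump x 0 ` S = x ` S"
      by (intro image_cong refl) (simp add: bump_def)
    then show ?thesis by (simp add: peak_def)
  qed
  from expectation_loads[where g = "peak S", OF assms(1-3) _ this, of v T] assms(4)
  have "measure_pmf.expectation (customers_pmf v T S) (\<lambda>c. peak S (load T c)) =
     (step N (choice_prob v S) ^^ T) (peak S) (\<lambda>_. 0)" by blast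
  moreover have "real (max_load T S c) = peak S (load T c)" for c
    by (simp add: max_load_def peak_def)
  ultimately show ?thesis
    by (simp add: expected_max_load_def)
qed

section \<open>Monotonicity and thinning\<close>

definition increasing :: "nat set \<Rightarrow> ((nat \<Rightarrow> nat) \<Rightarrow> real) \<Rightarrow> bool" where
  "increasing N g \<longleftrightarrow> (\<forall>x. \<forall>a\<in>N. g x \<le> g (bump x a))"

lemma step_increasing:
  assumes "subdist N p" "increasing N g"
  shows "increasing N (step N p g)"
  unfolding increasing_def
proof (intro allI ballI)
  fix x b assume b: "b \<in> N"
  have "step N p g x \<le> step N p (\<lambda>x. g (bump x b)) x"
    using step_mono[OF assms(1)] assms(2) b by (simp add: increasing_def)
  also have "\<dots> = step N p g (bump x b)"
    by (simp add: step_def bump_commute[of x b])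
  finally show "step N p g x \<le> step N p g (bump x b)" .
qed

lemma iterate_step_mono_probs:
  assumes "subdist N p" "subdist N q" "\<And>a. a \<in> N \<Longrightarrow> p a \<le> q a" "increasing N g"
  shows "(step N p ^^ T) g x \<le> (step N q ^^ T) g x"
proof (induction T arbitrary: x)
  case (Suc T)
  have inc: "increasing N ((step N q ^^ T) g)"
    by (induction T) (simp_all add: assms step_increasing)
  have "step N p G x \<le> step N q G x" if "increasing N G" for G
    unfolding step_def using that assms(3)
    by (intro add_left_mono sum_mono mult_right_mono) (auto simp: increasing_def)
  note this[OF inc]
  moreover have "step N p ((step N p ^^ T) g) x \<le> step N p ((step N q ^^ T) g) x"
    by (intro step_mono assms Suc.IH)
  ultimately show ?case by simp
qed simp

lemma step_half:
  "step N (\<lambda>a. p a / 2) g x = (1 - sum p N) * g x + (\<Sum>a\<in>N. p a / 2 * (g (bump x a) + g x))"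
proof -
  have "(\<Sum>a\<in>N. p a / 2 * (g (bump x a) - g x)) = (\<Sum>a\<in>N. p a / 2 * (g (bump x a) + g x) - p a * g x)"
    by (intro sum.cong) (simp_all add: field_simps)
  then show ?thesis
    by (simp add: step_def sum_subtractf sum_distrib_right left_diff_distrib)
qed

text \<open>Coupling of a population of customers with its random split into two halves: the loads \<open>x + y\<close>
  are split as \<open>x\<close> and \<open>y\<close>, and each purchase goes to one of the parts by a fair coin. Averaged over the
  coin, each part alone sees purchases with probabilities \<open>p / 2\<close>, and \<open>g\<close> is subadditive.\<close>

lemma thinning:
  assumes "subdist N p" "\<And>x y. g (\<lambda>i. x i + y i) \<le> g x + g y"
  shows "(step N p ^^ T) g (\<lambda>i. x i + y i) \<le>
    (step N (\<lambda>a. p a / 2) ^^ T) g x + (step N (\<lambda>a. p a / 2) ^^ T) g y"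
proof (induction T arbitrary: x y)
  case (Suc T)
  let ?G = "(step N p ^^ T) g" and ?H = "(step N (\<lambda>a. p a / 2) ^^ T) g"
  let ?s = "\<lambda>x y i. x i + y i :: nat"
  have bump_left: "bump (?s x y) a = ?s (bump x a) y" 
    and bump_right: "bump (?s x y) a = ?s x (bump y a)" for a
    by (auto simp: bump_def fun_eq_iff)
  \<comment> \<open>the next purchase goes to the first part or to the second\<close>
  have *: "2 * ?G (bump (?s x y) a) \<le> ?H (bump x a) + ?H y + (?H x + ?H (bump y a))" for a
    using Suc.IH[of "bump x a" y] Suc.IH[of x "bump y a"] bump_left[of a] bump_right[of a] by simp
  have "step N p ?G (?s x y) = (1 - sum p N) * ?G (?s x y) + (\<Sum>a\<in>N. p a / 2 * (2 * ?G (bump (?s x y) a)))"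
    by (simp add: step_convex_form)
  also have "\<dots> \<le> (1 - sum p N) * (?H x + ?H y) +
     (\<Sum>a\<in>N. p a / 2 * (?H (bump x a) + ?H y + (?H x + ?H (bump y a))))"
    using assms(1) * Suc.IH[of x y]
    by (intro add_mono mult_left_mono sum_mono) (auto simp: subdist_def)
  also have "\<dots> = step N (\<lambda>a. p a / 2) ?H x + step N (\<lambda>a. p a / 2) ?H y"
    unfolding step_half[of N p ?H] by (simp add: distrib_left sum.distrib)
  finally show ?case by simp
qed (use assms(2) in simp)

section \<open>Moving probability between two products\<close>

definition move_prob :: "nat \<Rightarrow> nat \<Rightarrow> (nat \<Rightarrow> real) \<Rightarrow> real \<Rightarrow> nat \<Rightarrow> real" where
  "move_prob i k p s = p(i := p i + s, k := p k - s)"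

definition diff :: "nat \<Rightarrow> nat \<Rightarrow> ((nat \<Rightarrow> nat) \<Rightarrow> real) \<Rightarrow> (nat \<Rightarrow> nat) \<Rightarrow> real" where
  "diff i k g x = g (bump x i) - g (bump x k)"

lemma sum_move_prob:
  assumes "finite N" "i \<in> N" "k \<in> N" "i \<noteq> k"
  shows "(\<Sum>a\<in>N. move_prob i k p s a * f a) = (\<Sum>a\<in>N. p a * f a) + s * (f i - f k)"
proof -
  have *: "move_prob i k p s a * f a = p a * f a + (if a = i then s * f a else 0) - (if a = k then s * f a else 0)" for a
    using assms(4) by (auto simp: move_prob_def algebra_simps)
  show ?thesis
    unfolding * using assms by (simp add: sum.distrib sum_subtractf algebra_simps)
qed

lemma step_move_prob:
  assumes "finite N" "i \<in> N" "k \<in> N" "i \<noteq> k"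
  shows "step N (move_prob i k p b) g x = step N (move_prob i k p a) g x + (b - a) * diff i k g x"
  unfolding step_def sum_move_prob[OF assms] by (simp add: diff_def algebra_simps)

lemma subdist_move_prob:
  assumes "subdist N p" "i \<in> N" "k \<in> N" "i \<noteq> k" "- p i \<le> s" "s \<le> p k"
  shows "subdist N (move_prob i k p s)"
proof -
  have "sum (move_prob i k p s) N = sum p N"
    using sum_move_prob[of N i k p s "\<lambda>_. 1"] assms by (simp add: subdist_def)
  then show ?thesis
    using assms by (auto simp: subdist_def move_prob_def)
qed

lemma diff_step: "diff i k (step N p g) = step N p (diff i k g)"
proof
  fix x
  show "diff i k (step N p g) x = step N p (diff i k g) x"
    unfolding diff_def step_diff by (simp add: step_def bump_commute)
qed

lemma diff_iterate_step: "diff i k ((step N p ^^ T) g) = (step N p ^^ T) (diff i k g)"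
  by (induction T) (simp_all add: diff_step)

text \<open>The derivative of the expectation in the amount moved is \<open>T\<close> times an expectation of \<open>diff i k\<close>
  over \<open>T - 1\<close> customers. Monotonicity of the latter in the amount is thus the convexity of the former;
  stated for \<open>diff\<close>, it needs no differentiation.\<close>

lemma diff_iterate_step_mono:
  assumes N: "finite N" "i \<in> N" "k \<in> N" "i \<noteq> k"
    and "subdist N (move_prob i k p a)" "subdist N (move_prob i k p b)" "a \<le> b"
    and convex: "\<And>x. 0 \<le> diff i k (diff i k g) x"
  shows "diff i k ((step N (move_prob i k p a) ^^ T) g) x \<le> diff i k ((step N (move_prob i k p b) ^^ T) g) x"
proof (induction T arbitrary: x)
  case (Suc T)
  let ?E = "\<lambda>s. (step N (move_prob i k p s) ^^ T) g"
  have "step N (move_prob i k p a) (diff i k (?E a)) x \<le> step N (move_prob i k p a) (diff i k (?E b)) x"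
    by (intro step_mono assms Suc.IH)
  also have "\<dots> \<le> step N (move_prob i k p a) (diff i k (?E b)) x + (b - a) * diff i k (diff i k (?E b)) x"
    using iterate_step_nonneg[OF assms(6) convex] assms(7) by (simp add: diff_iterate_step)
  also have "\<dots> = step N (move_prob i k p b) (diff i k (?E b)) x"
    by (rule step_move_prob[OF N, symmetric])
  finally show ?case by (simp add: diff_step)
qed simp

text \<open>Each additional customer contributes \<open>- u w (b - a)\<close> times an increment of \<open>diff i k\<close> from \<open>a\<close> to
  \<open>b\<close>, which the previous lemma shows to be nonnegative.\<close>

lemma iterate_step_convex:
  assumes N: "finite N" "i \<in> N" "k \<in> N" "i \<noteq> k"
    and "subdist N (move_prob i k p a)" "subdist N (move_prob i k p b)"
        "subdist N (move_prob i k p (u * a + w * b))" "a \<le> b" "0 \<le> u" "0 \<le> w" "u + w = 1"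
    and convex: "\<And>x. 0 \<le> diff i k (diff i k g) x"
  shows "(step N (move_prob i k p (u * a + w * b)) ^^ T) g x \<le>
    u * (step N (move_prob i k p a) ^^ T) g x + w * (step N (move_prob i k p b) ^^ T) g x"
proof (induction T arbitrary: x)
  case 0
  show ?case using assms(11) by (simp flip: distrib_right)
next
  case (Suc T)
  let ?c = "u * a + w * b"
  let ?S = "\<lambda>s. step N (move_prob i k p s)"
  let ?E = "\<lambda>s. (?S s ^^ T) g"
  have u: "u = 1 - w" using assms(11) by simp
  have "?S ?c (?E ?c) x \<le> ?S ?c (\<lambda>x. u * ?E a x + w * ?E b x) x"
    by (intro step_mono assms Suc.IH)
  also have "\<dots> = u * (?S a (?E a) x + (?c - a) * diff i k (?E a) x) +
      w * (?S b (?E b) x + (?c - b) * diff i k (?E b) x)"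
    unfolding step_linear
      step_move_prob[OF N, of p ?c "?E a" x a] step_move_prob[OF N, of p ?c "?E b" x b] ..
  also have "\<dots> = u * ?S a (?E a) x + w * ?S b (?E b) x -
      u * w * (b - a) * (diff i k (?E b) x - diff i k (?E a) x)"
    unfolding u by (simp add: algebra_simps)
  also have "\<dots> \<le> u * ?S a (?E a) x + w * ?S b (?E b) x"
    using diff_iterate_step_mono[OF N assms(5,6,8) convex, of T x] assms(8-10) by simp
  finally show ?case by simp
qed

lemma iterate_step_swap:
  assumes "i \<in> N" "k \<in> N" "\<And>x. g (x \<circ> Transposition.transpose i k) = g x"
  shows "(step N (p \<circ> Transposition.transpose i k) ^^ T) g (x \<circ> Transposition.transpose i k) = (step N p ^^ T) g x"
proof (induction T arbitrary: x)
  case (Suc T)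
  let ?t = "Transposition.transpose i k"
  have bump: "bump (x \<circ> ?t) (?t a) = bump x a \<circ> ?t" for a
    by (auto simp: bump_def fun_eq_iff transpose_eq_iff)
  have bij: "bij_betw ?t N N"
    using assms by (intro bij_betw_byWitness[where f' = ?t]) (auto simp: transpose_def)
  have swap: "step N (p \<circ> ?t) G (x \<circ> ?t) = step N p H x" if "\<And>y. G (y \<circ> ?t) = H y" for G H
  proof -
    have "step N (p \<circ> ?t) G (x \<circ> ?t) = H x + (\<Sum>a\<in>N. p (?t a) * (G (bump (x \<circ> ?t) a) - H x))"
      by (simp add: step_def that)
    also have "(\<Sum>a\<in>N. p (?t a) * (G (bump (x \<circ> ?t) a) - H x)) =
        (\<Sum>a\<in>N. p (?t (?t a)) * (G (bump (x \<circ> ?t) (?t a)) - H x))"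
      by (rule sum.reindex_bij_betw[OF bij, symmetric])
    also have "H x + \<dots> = step N p H x"
      unfolding bump that by (simp add: step_def)
    finally show ?thesis .
  qed
  have "step N (p \<circ> ?t) ((step N (p \<circ> ?t) ^^ T) g) (x \<circ> ?t) = step N p ((step N p ^^ T) g) x"
    by (rule swap) (rule Suc.IH)
  then show ?case by (simp only: funpow.simps comp_apply[where f = "step N q" for q])
qed (use assms(3) in simp)

text \<open>Moving \<open>s\<close> and moving \<open>p k - p i - s\<close> produce the same probabilities up to exchanging \<open>i\<close> and \<open>k\<close>,
  hence the same expectation. The hypotheses on \<open>s\<close> place the amount \<open>0\<close> between these two, so that
  convexity bounds the value at \<open>0\<close> by the common value.\<close>

lemma move_prob_increases:
  assumes "subdist N p" "i \<in> N" "k \<in> N" "i \<noteq> k" "0 \<le> s" "p k - p i \<le> s" "s \<le> p k"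
    and convex: "\<And>x. 0 \<le> diff i k (diff i k g) x"
    and symmetric: "\<And>x. g (x \<circ> Transposition.transpose i k) = g x"
  shows "(step N p ^^ T) g (\<lambda>_. 0) \<le> (step N (move_prob i k p s) ^^ T) g (\<lambda>_. 0)"
proof (cases "s = 0")
  case True
  then show ?thesis by (simp add: move_prob_def)
next
  case False
  define a where "a = p k - p i - s"
  \<comment> \<open>the weight with \<open>0 = (1 - w) * a + w * s\<close>\<close>
  define w where "w = - a / (s - a)"
  have as: "a \<le> 0" "0 < s" "a < s" using assms False by (auto simp: a_def)
  have fin: "finite N" using assms(1) by (simp add: subdist_def)
  have "move_prob i k p a = move_prob i k p s \<circ> Transposition.transpose i k"
    using assms(4) by (auto simp: move_prob_def a_def fun_eq_iff transpose_def)
  then have mirror: "(step N (move_prob i k p a) ^^ T) g (\<lambda>_. 0) = (step N (move_prob i k p s) ^^ T) g (\<lambda>_. 0)"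
    using iterate_step_swap[where g = g, OF assms(2,3) symmetric, of T "move_prob i k p s" "\<lambda>_. 0"]
    by (simp add: comp_def)
  have w: "0 \<le> w" "w \<le> 1" "(1 - w) * a + w * s = 0"
    using as by (simp_all add: w_def field_simps)
  have p: "move_prob i k p 0 = p" by (simp add: move_prob_def)
  have nn: "0 \<le> p i" "0 \<le> p k" using assms by (auto simp: subdist_def)
  have sub: "subdist N (move_prob i k p a)" "subdist N (move_prob i k p s)"
    using assms nn by (auto simp: a_def intro!: subdist_move_prob)
  have sub0: "subdist N (move_prob i k p ((1 - w) * a + w * s))"
    unfolding w(3) p by (rule assms(1))
  have "(step N p ^^ T) g (\<lambda>_. 0) \<le> (1 - w) * (step N (move_prob i k p a) ^^ T) g (\<lambda>_. 0) +
     w * (step N (move_prob i k p s) ^^ T) g (\<lambda>_. 0)"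
    using iterate_step_convex[OF fin assms(2-4) sub sub0 _ _ _ _ convex, of T "\<lambda>_. 0"] as w
    by (simp add: p)
  then show ?thesis
    unfolding mirror by (simp add: algebra_simps)
qed

section \<open>Properties of the maximum and comparison of distributions\<close>

lemma peak_le_iff:
  assumes "finite N" "N \<noteq> {}"
  shows "peak N x \<le> c \<longleftrightarrow> (\<forall>a\<in>N. real (x a) \<le> c)"
proof -
  have "Max (x ` N) \<in> x ` N" using assms by (intro Max_in) auto
  then obtain b where b: "b \<in> N" "Max (x ` N) = x b" by blast
  then have peak: "peak N x = real (x b)" using assms by (simp add: peak_def)
  then have "real (x a) \<le> real (x b)" if "a \<in> N" for a
    using assms that by (simp flip: b(2))
  with b(1) peak show ?thesis by fastforce
qed

lemma le_peak: "finite N \<Longrightarrow> a \<in> N \<Longrightarrow> real (x a) \<le> peak N x"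
  by (auto simp: peak_def)

lemma peak_subadditive:
  assumes "finite N"
  shows "peak N (\<lambda>i. x i + y i) \<le> peak N x + peak N y"
proof (cases "N = {}")
  case False
  show ?thesis
    unfolding peak_le_iff[OF assms False] by (auto intro: add_mono le_peak assms)
qed (simp add: peak_def)

lemma peak_increasing:
  assumes "finite N"
  shows "increasing N (peak N)"
  unfolding increasing_def
proof (intro allI ballI)
  fix x a assume "a \<in> N"
  then have ne: "N \<noteq> {}" by auto
  have "real (x b) \<le> peak N (bump x a)" if "b \<in> N" for b
    using le_peak[OF assms that, of "bump x a"] by (auto simp: bump_def split: if_splits)
  then show "peak N x \<le> peak N (bump x a)"
    unfolding peak_le_iff[OF assms ne] by blast
qed

lemma peak_symmetric:
  assumes "i \<in> N" "k \<in> N"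
  shows "peak N (x \<circ> Transposition.transpose i k) = peak N x"
proof -
  have "Transposition.transpose i k ` N = N"
    using assms by simp
  then have "(x \<circ> Transposition.transpose i k) ` N = x ` N"
    by (metis image_comp)
  then show ?thesis by (simp add: peak_def)
qed

text \<open>The loads \<open>x + e\<^sub>i + e\<^sub>k\<close> are the midpoint of \<open>x + 2 e\<^sub>i\<close> and \<open>x + 2 e\<^sub>k\<close>.\<close>

lemma peak_convex:
  assumes "finite N" "N \<noteq> {}"
  shows "0 \<le> diff i k (diff i k (peak N)) x"
proof -
  let ?ii = "bump (bump x i) i" and ?kk = "bump (bump x k) k" and ?ik = "bump (bump x i) k"
  have "real (?ik a) \<le> (peak N ?ii + peak N ?kk) / 2" if "a \<in> N" for a
    using le_peak[OF assms(1) that, of ?ii] le_peak[OF assms(1) that, of ?kk]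
    by (auto simp: bump_def split: if_splits)
  then have "peak N ?ik \<le> (peak N ?ii + peak N ?kk) / 2"
    unfolding peak_le_iff[OF assms] by blast
  then show ?thesis
    unfolding diff_def by (simp add: bump_commute[of x k i])
qed

text \<open>While some product \<open>k\<close> outside \<open>J\<close> still has positive probability, the mass condition leaves a
  product \<open>i \<in> J\<close> with \<open>r i < q i\<close>. Moving as much as possible from \<open>k\<close> to \<open>i\<close> exhausts \<open>k\<close> or fills
  \<open>i\<close>, so one of the two kinds of unfinished products becomes rarer. Since \<open>r k \<le> q i\<close>, the amount
  moved is at least \<open>r k - r i\<close>, as the preceding exchange argument demands. Once nothing is left
  outside \<open>J\<close>, \<open>r \<le> q\<close> everywhere.\<close>

lemma peak_dominated:
  assumes "subdist N r" "subdist N q" "J \<subseteq> N"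
    and "\<And>i. i \<in> J \<Longrightarrow> r i \<le> q i"
    and "\<And>i k. i \<in> J \<Longrightarrow> k \<in> N - J \<Longrightarrow> r k \<le> q i"
    and "sum r N \<le> sum q J"
  shows "(step N r ^^ T) (peak N) (\<lambda>_. 0) \<le> (step N q ^^ T) (peak N) (\<lambda>_. 0)"
  using assms
proof (induction "card {k \<in> N - J. r k \<noteq> 0} + card {i \<in> J. r i \<noteq> q i}" arbitrary: r rule: less_induct)
  case less
  note r = less.prems(1) and q = less.prems(2)
  have fin: "finite N" "finite J" and nn: "\<And>a. a \<in> N \<Longrightarrow> 0 \<le> r a"
    using r less.prems(3) finite_subset by (auto simp: subdist_def)
  show ?case
  proof (cases "\<exists>k\<in>N - J. r k \<noteq> 0")
    case False
    then have "r a \<le> q a" if "a \<in> N" for a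
      using less.prems(4)[of a] q that by (cases "a \<in> J") (auto simp: subdist_def)
    then show ?thesis
      by (intro iterate_step_mono_probs r q peak_increasing fin)
  next
    case True
    then obtain k where k: "k \<in> N" "k \<notin> J" "r k \<noteq> 0" by blast
    have "0 < sum r (N - J)"
      using k nn fin by (intro sum_pos2[of _ k]) (auto simp: less_le)
    moreover have "sum r N = sum r J + sum r (N - J)"
      using fin less.prems(3) by (simp add: sum.subset_diff add.commute)
    ultimately have "sum r J < sum q J"
      using less.prems(6) by simp
    then have "\<exists>i\<in>J. r i < q i"
      using sum_mono[of J q r] by (meson not_less)
    then obtain i where i: "i \<in> J" "r i < q i" by blast
    then have iN: "i \<in> N" and ik: "i \<noteq> k" using less.prems(3) k by auto
    define s where "s = min (q i - r i) (r k)"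
    define r' where "r' = move_prob i k r s"
    have s: "0 \<le> s" "r k - r i \<le> s" "s \<le> r k" "s \<le> q i - r i"
      using i k nn[of i] nn[of k] iN less.prems(5)[of i k] by (auto simp: s_def)
    have r'i: "r' i = r i + s" and r'k: "r' k = r k - s" 
      and r'other: "\<And>a. a \<noteq> i \<Longrightarrow> a \<noteq> k \<Longrightarrow> r' a = r a"
      using ik by (auto simp: r'_def move_prob_def)
    have sub': "subdist N r'"
      unfolding r'_def using s nn[OF iN] by (intro subdist_move_prob r iN k ik) auto
    have le_in: "r' a \<le> q a" if "a \<in> J" for a
    proof (cases "a = i")
      case False
      moreover have "a \<noteq> k" using that k by blast
      ultimately show ?thesis using that less.prems(4)[of a] r'other[of a] by simp
    qed (use r'i s in simp)
    have le_out: "r' b \<le> q a" if "a \<in> J" "b \<in> N - J" for a b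
    proof (cases "b = k")
      case False
      moreover have "b \<noteq> i" using that i by blast
      ultimately show ?thesis using that less.prems(5)[of a b] r'other[of b] by simp
    qed (use that less.prems(5)[of a k] k r'k s in simp)
    have sum': "sum r' N = sum r N"
      using sum_move_prob[OF fin(1) iN k(1) ik, of r s "\<lambda>_. 1"] by (simp add: r'_def)
    let ?A = "\<lambda>r. {k \<in> N - J. r k \<noteq> 0}" and ?B = "\<lambda>r. {i \<in> J. r i \<noteq> q i}"
    have A: "?A r' \<subseteq> ?A r"
      using r'other i k by force
    have B: "?B r' \<subseteq> ?B r"
    proof
      fix a assume a: "a \<in> ?B r'"
      then have "a \<noteq> k" using k by blast
      then show "a \<in> ?B r"
        using a i r'other[of a] by (cases "a = i") auto
    qed
    have finAB: "finite (?A r)" "finite (?B r)" using fin by auto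
    have "card (?A r') + card (?B r') < card (?A r) + card (?B r)"
    proof (cases "s = r k")
      case True
      then have "k \<in> ?A r" "k \<notin> ?A r'" using k r'k by auto
      then have "card (?A r') < card (?A r)"
        using A finAB by (intro psubset_card_mono) blast+
      then show ?thesis using card_mono[OF finAB(2) B] by simp
    next
      case False
      then have "i \<in> ?B r" "i \<notin> ?B r'" using i r'i by (auto simp: s_def min_def split: if_splits)
      then have "card (?B r') < card (?B r)"
        using B finAB by (intro psubset_card_mono) blast+
      then show ?thesis using card_mono[OF finAB(1) A] by simp
    qed
    then have "(step N r' ^^ T) (peak N) (\<lambda>_. 0) \<le> (step N q ^^ T) (peak N) (\<lambda>_. 0)"
      using less.hyps[OF _ sub' q less.prems(3) le_in le_out] sum' less.prems(6) by simp
    moreover have "(step N r ^^ T) (peak N) (\<lambda>_. 0) \<le> (step N r' ^^ T) (peak N) (\<lambda>_. 0)"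
      unfolding r'_def using iN k fin s
      by (intro move_prob_increases[OF r iN k(1) ik] peak_convex peak_symmetric) auto
    ultimately show ?thesis by simp
  qed
qed

section \<open>Half-optimality of the greedy prefix\<close>

lemma subdist_choice_prob:
  assumes "finite N" "0 \<notin> N" "S \<subseteq> N" "\<And>i. i \<in> S \<Longrightarrow> v i > 0"
  shows "subdist N (choice_prob v S)"
    and "sum (choice_prob v S) N = total_weight v S / (1 + total_weight v S)"
proof -
  have W: "0 \<le> total_weight v S"
    unfolding total_weight_def by (intro sum_nonneg) (use assms in \<open>auto intro: less_imp_le\<close>)
  have "sum (choice_prob v S) N = sum (choice_prob v S) S"
    using assms by (intro sum.mono_neutral_right) (auto simp: choice_prob_def)
  also have "\<dots> = (\<Sum>i\<in>S. v i / (1 + total_weight v S))"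
    using assms by (intro sum.cong) (auto simp: choice_prob_def)
  finally show eq: "sum (choice_prob v S) N = total_weight v S / (1 + total_weight v S)"
    by (simp add: total_weight_def sum_divide_distrib)
  show "subdist N (choice_prob v S)"
    unfolding subdist_def eq using assms W
    by (auto simp: choice_prob_def divide_simps less_imp_le)
qed

text \<open>The middle condition says that the products before \<open>j\<close> weigh less than \<open>1\<close>.\<close>

definition greedy_prefix :: "nat \<Rightarrow> (nat \<Rightarrow> real) \<Rightarrow> nat \<Rightarrow> bool" where
  "greedy_prefix n v j \<longleftrightarrow> j \<in> {1..n} \<and> sum v {1..j} < 1 + v j \<and> (j = n \<or> 1 \<le> sum v {1..j})"

lemma expected_max_load_le_greedy:
  assumes inst: "mnl_instance n T v" and j: "greedy_prefix n v j" and S: "S \<subseteq> {1..n}"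
  shows "expected_max_load v T S \<le> 2 * expected_max_load v T {1..j}"
proof -
  define N J where "N = {1..n}" and "J = {1..j}"
  have N: "finite N" "0 \<notin> N" "N \<noteq> {}" and J: "J \<subseteq> N" "J \<noteq> {}" and SN: "S \<subseteq> N"
    using j S by (auto simp: N_def J_def greedy_prefix_def)
  have pos: "v i > 0" if "i \<in> N" for i
    using inst that by (auto simp: mnl_instance_def N_def)
  have anti: "v k \<le> v i" if "i \<in> N" "k \<in> N" "i \<le> k" for i k
    using inst that by (auto simp: mnl_instance_def N_def monotone_on_def)
  define p q where "p = choice_prob v S" and "q = choice_prob v J"
  define r where "r = (\<lambda>a. p a / 2)"
  define W where "W = total_weight v J"
  have W: "0 < W" "W < 1 + v j" "j = n \<or> 1 \<le> W"
    using j J(2) pos J(1) by (auto simp: greedy_prefix_def W_def J_def total_weight_def intro!: sum_pos)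
  have p: "subdist N p" "sum p N = total_weight v S / (1 + total_weight v S)"
    unfolding p_def using subdist_choice_prob[OF N(1,2) SN] pos SN by auto
  have q: "subdist N q" "sum q N = W / (1 + W)"
    unfolding q_def W_def using subdist_choice_prob[OF N(1,2) J(1)] pos J(1) by auto
  have qJ: "sum q N = sum q J"
    using N J by (intro sum.mono_neutral_right) (auto simp: q_def choice_prob_def)
  have WS: "0 \<le> total_weight v S"
    unfolding total_weight_def by (intro sum_nonneg) (use pos SN in \<open>auto intro: less_imp_le\<close>)
  have r_eq: "sum r N = sum p N / 2"
    by (simp add: r_def sum_divide_distrib)
  have r: "subdist N r" "sum r N \<le> 1 / 2"
    using p(1) unfolding subdist_def r_eq by (auto simp: r_def)
  have r_le: "r k \<le> q i" if i: "i \<in> J" and k: "k \<in> N" "i \<le> k" for i k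
  proof (cases "k \<in> S")
    case True
    have iN: "i \<in> N" and jN: "j \<in> N" and "i \<le> j" using i J by (auto simp: J_def)
    have vi: "0 < v i" "v k \<le> v i" "v j \<le> v i" "0 < v k"
      using anti[OF iN k] anti[OF iN jN] pos iN k \<open>i \<le> j\<close> by auto
    have "v k \<le> total_weight v S"
      unfolding total_weight_def using True pos SN finite_subset[OF SN N(1)]
      by (intro member_le_sum) (auto intro: less_imp_le)
    moreover have "k \<noteq> 0" using k N(2) by metis
    then have "r k = v k / (2 * (1 + total_weight v S))"
      using True by (simp add: r_def p_def choice_prob_def)
    ultimately have "r k \<le> v k / (2 * (1 + v k))"
      using vi WS by (auto intro!: divide_left_mono)
    also have "\<dots> \<le> v i / (2 * (1 + v i))"
      using vi by (simp add: field_simps)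
    also have "\<dots> \<le> v i / (1 + W)"
      using vi W by (intro divide_left_mono) auto
    also have "\<dots> = q i"
      using i J N by (auto simp: q_def choice_prob_def W_def)
    finally show ?thesis .
  next
    case False
    have "0 \<le> q i" using q J i by (auto simp: subdist_def)
    with False k N show ?thesis by (auto simp: r_def p_def choice_prob_def)
  qed
  have r_sum: "sum r N \<le> sum q J"
    using W(3)
  proof
    assume "j = n"
    then have "N = J" by (simp add: N_def J_def)
    then show ?thesis using r_le by (auto intro!: sum_mono)
  next
    assume "1 \<le> W"
    then have "1 / 2 \<le> sum q N" by (simp add: q field_simps)
    then show ?thesis using r(2) qJ by simp
  qed
  have "expected_max_load v T S = (step N p ^^ T) (peak S) (\<lambda>_. 0)"
    unfolding p_def using N SN pos by (intro expected_max_load_eq) auto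
  also have "\<dots> \<le> (step N p ^^ T) (peak N) (\<lambda>_. 0)"
  proof (rule iterate_step_mono[OF p(1)])
    fix x
    show "peak S x \<le> peak N x"
    proof (cases "S = {}")
      case False
      then show ?thesis
        using peak_le_iff[of S x "peak N x"] finite_subset[OF SN N(1)] SN le_peak[OF N(1)] by blast
    qed (simp add: peak_def)
  qed
  also have "\<dots> \<le> 2 * (step N r ^^ T) (peak N) (\<lambda>_. 0)"
    using thinning[where T = T and g = "peak N", OF p(1) peak_subadditive[OF N(1)], of "\<lambda>_. 0" "\<lambda>_. 0"] by (simp add: r_def)
  also have "(step N r ^^ T) (peak N) (\<lambda>_. 0) \<le> (step N q ^^ T) (peak N) (\<lambda>_. 0)"
    using J by (intro peak_dominated[OF r(1) q(1) J(1) _ _ r_sum] r_le) (auto simp: J_def N_def)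
  also have "(step N q ^^ T) (peak N) (\<lambda>_. 0) = (step N q ^^ T) (peak J) (\<lambda>_. 0)"
  proof (rule iterate_step_cong_on_support[where J = J])
    fix x :: "nat \<Rightarrow> nat" assume x: "\<And>a. a \<in> N - J \<Longrightarrow> x a = 0"
    have finJ: "finite J" by (simp add: J_def)
    have "real (x a) \<le> peak J x" if "a \<in> N" for a
      using that x[of a] le_peak[OF finJ, of a x] by (cases "a \<in> J") (auto simp: peak_def)
    then have "peak N x \<le> peak J x" using peak_le_iff[OF N(1,3)] by blast
    moreover have "peak J x \<le> peak N x"
      using peak_le_iff[OF finJ J(2)] le_peak[OF N(1)] J(1) by blast
    ultimately show "peak N x = peak J x" by simp
  qed (use N in \<open>auto simp: q_def choice_prob_def\<close>)
  also have "\<dots> = expected_max_load v T {1..j}"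
    unfolding q_def J_def[symmetric] using N J pos by (intro expected_max_load_eq[symmetric]) auto
  finally show ?thesis by simp
qed

lemma half_optimal_greedy:
  assumes "mnl_instance n T v" "greedy_prefix n v j"
  shows "half_optimal n T v {1..j}"
proof -
  have "Max (expected_max_load v T ` Pow {1..n}) \<le> 2 * expected_max_load v T {1..j}"
    using expected_max_load_le_greedy[OF assms] by (subst Max_le_iff) auto
  then show ?thesis by (simp add: half_optimal_def)
qed

section \<open>A linear-time program for the greedy prefix\<close>

text \<open>Cell \<open>0\<close> accumulates the weight of the first \<open>i\<close> products, where \<open>i\<close> is in register \<open>2\<close>. Register
  \<open>3\<close> holds the increment \<open>1\<close>; registers \<open>4\<close> and \<open>5\<close> hold the addresses of the accumulator and of the
  threshold \<open>1\<close>. The threshold sits in cell \<open>n + 1\<close>, where it is also a sentinel: treated as the weight of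
  an additional product, it stops the scan after at most \<open>n + 1\<close> rounds without a bound check.\<close>

definition scan_loop :: program where
  "scan_loop = While (Real_Less 4 5) (Seq (Index_Add 2 2 3) (Real_Arith Plus 4 4 2))"

text \<open>The final conditional caps the answer at \<open>n\<close>, in case the sentinel was counted. Register \<open>4\<close> holds
  \<open>0\<close>, so adding it copies register \<open>2\<close>; the assignment to register \<open>6\<close> serves as a no-op.\<close>

definition greedy_program :: program where
  "greedy_program =
     Seq (Index_Const 3 1) (Seq (Index_Add 5 0 3) (Seq (Real_Const 5 1)
       (Seq scan_loop (Cond (Index_Less 2 0) (Index_Add 0 2 4) (Index_Const 6 0)))))"

lemma runs_scan_loop:
  assumes "i \<le> j" "j \<le> l" "0 < l" "m l = 1" "r 3 = 1" "r 4 = 0" "r 5 = l"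
    and "\<And>i. i < j \<Longrightarrow> sum m {1..i} < 1" "1 \<le> sum m {1..j}"
  shows "runs scan_loop (r(2 := i), m(0 := sum m {1..i})) (3 * (j - i) + 1)
    (r(2 := j), m(0 := sum m {1..j}))"
  using assms(1)
proof (induction "j - i" arbitrary: i)
  case 0
  then have "i = j" by simp
  have "runs scan_loop (r(2 := j), m(0 := sum m {1..j})) 1 (r(2 := j), m(0 := sum m {1..j}))"
    unfolding scan_loop_def using assms by (intro runs.While_False) auto
  moreover have "3 * (j - j) + 1 = (1::nat)" by simp
  ultimately show ?case unfolding \<open>i = j\<close> by (simp only:)
next
  case (Suc d)
  let ?s = "\<lambda>i. (r(2 := i), m(0 := sum m {1..i}))"
  have ij: "i < j" "d = j - Suc i" using Suc by auto
  have "runs (Index_Add 2 2 3) (?s i) 1 (r(2 := Suc i), m(0 := sum m {1..i}))"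
    using runs.Index_Add[of 2 2 3 "r(2 := i)"] assms(5) by simp
  moreover have "runs (Real_Arith Plus 4 4 2) (r(2 := Suc i), m(0 := sum m {1..i})) 1 (?s (Suc i))"
    using runs.Real_Arith[of Plus "m(0 := sum m {1..i})" "r(2 := Suc i)" 2 4 4] assms(6)
    by (simp add: atLeastAtMostSuc_conv add.commute)
  ultimately have "runs (Seq (Index_Add 2 2 3) (Real_Arith Plus 4 4 2)) (?s i) (1 + 1) (?s (Suc i))"
    by (rule runs.Seq)
  then have body: "runs (Seq (Index_Add 2 2 3) (Real_Arith Plus 4 4 2)) (?s i) 2 (?s (Suc i))"
    by (simp only: one_add_one)
  have rest: "runs scan_loop (?s (Suc i)) (3 * (j - Suc i) + 1) (?s j)"
    using Suc.hyps(1)[OF ij(2)] ij by simp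
  have "runs scan_loop (?s i) (Suc (2 + (3 * (j - Suc i) + 1))) (?s j)"
    unfolding scan_loop_def
    by (rule runs.While_True[OF _ body rest[unfolded scan_loop_def]]) (use assms ij in auto)
  moreover have "Suc (2 + (3 * (j - Suc i) + 1)) = 3 * (j - i) + 1" using ij by simp
  ultimately show ?case by simp
qed

lemma greedy_program_correct:
  assumes "mnl_instance n T v"
  shows "\<exists>k s. runs greedy_program (input_state n T v) k s \<and> k \<le> 3 * n + 9 \<and>
    greedy_prefix n v (output_index s)"
proof -
  define r :: "nat \<Rightarrow> nat" where "r = (\<lambda>_. 0)(0 := n, 1 := T, 3 := 1, 5 := Suc n)"
  define m where "m = (\<lambda>i. if i \<in> {1..n} then v i else 0)(Suc n := 1)"
  have pos: "v i > 0" if "i \<in> {1..n}" for i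
    using assms that by (auto simp: mnl_instance_def)
  have n1: "1 \<le> n"
    using assms by (simp add: mnl_instance_def)
  have sum_m: "sum m {1..i} = sum v {1..i}" if "i \<le> n" for i
    using that by (intro sum.cong) (auto simp: m_def)
  have "0 \<le> sum v {1..n}"
    by (intro sum_nonneg less_imp_le pos)
  then have end_ge: "1 \<le> sum m {1..Suc n}"
    using sum_m[of n] by (simp add: m_def)
  define j where "j = (LEAST j. 1 \<le> sum m {1..j})"
  have j: "1 \<le> sum m {1..j}" "j \<le> Suc n" "\<And>i. i < j \<Longrightarrow> sum m {1..i} < 1"
    using LeastI[of "\<lambda>j. 1 \<le> sum m {1..j}", OF end_ge]
      Least_le[of "\<lambda>j. 1 \<le> sum m {1..j}", OF end_ge]
      not_less_Least[of _ "\<lambda>j. 1 \<le> sum m {1..j}"]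
    unfolding j_def by (simp_all add: not_le)
  have j1: "1 \<le> j" using j(1) by (cases j) auto
  define out where "out = min j n"
  have "sum v {1..out - 1} < 1"
    using j(3)[of "out - 1"] sum_m[of "out - 1"] j1 n1 by (auto simp: out_def)
  moreover have "sum v {1..out} = sum v {1..out - 1} + v out"
    using j1 n1 by (cases out) (auto simp: out_def)
  moreover have "out = n \<or> 1 \<le> sum v {1..out}"
    using j(1) sum_m[of j] by (cases "j \<le> n") (auto simp: out_def min_def)
  ultimately have greedy: "greedy_prefix n v out"
    using j1 n1 by (auto simp: greedy_prefix_def out_def)
  let ?s = "(r(2 := j), m(0 := sum m {1..j}))"
  have "runs scan_loop (r(2 := 0), m(0 := sum m {1..0::nat})) (3 * (j - 0) + 1) ?s"
    by (rule runs_scan_loop[where l = "Suc n"]) (use j in \<open>auto simp: m_def r_def\<close>)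
  moreover have "r(2 := 0) = r" "m(0 := sum m {1..0}) = m"
    by (auto simp: r_def m_def)
  ultimately have loop: "runs scan_loop (r, m) (3 * j + 1) ?s" by simp
  define s where "s = (if j < n then (fst ?s)(0 := j) else (fst ?s)(6 := 0), snd ?s)"
  have last: "runs (Cond (Index_Less 2 0) (Index_Add 0 2 4) (Index_Const 6 0)) ?s (Suc 1) s"
  proof (cases "j < n")
    case True
    have "runs (Index_Add 0 2 4) ?s 1 s"
      using runs.Index_Add[of 0 2 4 "fst ?s" "snd ?s"] True by (simp add: s_def r_def)
    then show ?thesis using True by (intro runs.Cond_True) (auto simp: r_def)
  next
    case False
    have "runs (Index_Const 6 0) ?s 1 s"
      using runs.Index_Const[of 6 0 "fst ?s" "snd ?s"] False by (simp add: s_def)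
    then show ?thesis using False by (intro runs.Cond_False) (auto simp: r_def)
  qed
  define r0 :: "nat \<Rightarrow> nat" where "r0 = (\<lambda>_. 0)(0 := n, 1 := T)"
  define m0 where "m0 = (\<lambda>i. if i \<in> {1..n} then v i else 0)"
  have i1: "runs (Index_Const 3 1) (r0, m0) 1 (r0(3 := 1), m0)"
    by (rule runs.Index_Const)
  have "r0(3 := 1, 5 := (r0(3 := 1)) 0 + (r0(3 := 1)) 3) = r"
    by (auto simp: r0_def r_def)
  then have i2: "runs (Index_Add 5 0 3) (r0(3 := 1), m0) 1 (r, m0)"
    using runs.Index_Add[of 5 0 3 "r0(3 := 1)" m0] by simp
  have "m0(r 5 := real 1) = m"
    by (auto simp: m0_def m_def r_def)
  then have i3: "runs (Real_Const 5 1) (r, m0) 1 (r, m)"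
    using runs.Real_Const[of 5 1 r m0] by simp
  have "runs greedy_program (input_state n T v) (1 + (1 + (1 + (3 * j + 1 + Suc 1)))) s"
    unfolding greedy_program_def input_state_def r0_def[symmetric] m0_def[symmetric]
    by (intro runs.Seq[OF i1] runs.Seq[OF i2] runs.Seq[OF i3] runs.Seq[OF loop] last)
  moreover have "output_index s = out"
    by (auto simp: output_index_def s_def out_def r_def)
  ultimately show ?thesis
    using greedy j(2) by (intro exI[of _ "1 + (1 + (1 + (3 * j + 1 + Suc 1)))"] exI[of _ s]) auto
qed

theorem theorem3p7:
  shows "(\<forall>(n::nat) (T::nat) (v::nat \<Rightarrow> real). mnl_instance n T v \<longrightarrow>
            (\<exists>S \<subseteq> {1..n}. preference_weight_ordered n S \<and> half_optimal n T v S))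
       \<and> (\<exists>(p::program) (f::nat \<Rightarrow> nat \<Rightarrow> nat). polynomial2 f \<and>
            (\<forall>(n::nat) (T::nat) (v::nat \<Rightarrow> real). mnl_instance n T v \<longrightarrow>
               (\<exists>k s. runs p (input_state n T v) k s \<and> k \<le> f n T \<and>
                  preference_weight_ordered n {1..output_index s} \<and>
                  half_optimal n T v {1..output_index s})))"
proof -
  have prefix: "preference_weight_ordered n {1..j} \<and> half_optimal n T v {1..j} \<and> {1..j} \<subseteq> {1..n}"
    if "mnl_instance n T v" "greedy_prefix n v j" for n T v j
    using half_optimal_greedy[OF that] that(2)
    by (auto simp: preference_weight_ordered_def greedy_prefix_def)
  have poly: "polynomial2 (\<lambda>n T. 3 * n + 9)"
    unfolding polynomial2_def
    by (intro exI[of _ 1] exI[of _ "\<lambda>a b. if b = 0 then if a = 0 then 9 else 3 else 0"]) simp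
  show ?thesis
  proof (intro conjI allI impI)
    fix n T v assume "mnl_instance n T v"
    then show "\<exists>S \<subseteq> {1..n}. preference_weight_ordered n S \<and> half_optimal n T v S"
      using greedy_program_correct[of n T v] prefix by blast
  next
    show "\<exists>(p::program) (f::nat \<Rightarrow> nat \<Rightarrow> nat). polynomial2 f \<and>
            (\<forall>(n::nat) (T::nat) (v::nat \<Rightarrow> real). mnl_instance n T v \<longrightarrow>
               (\<exists>k s. runs p (input_state n T v) k s \<and> k \<le> f n T \<and>
                  preference_weight_ordered n {1..output_index s} \<and>
                  half_optimal n T v {1..output_index s}))"
      using greedy_program_correct prefix poly
      by (intro exI[of _ greedy_program] exI[of _ "\<lambda>n T. 3 * n + 9"]) blast
  qed
qed

end
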